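(* Let $F$ be a field of characteristic $p > 0$. For a finite subset $Y \subset F$ of size $r \geq 2$, the following are equivalent: (i) There are $g \in F[t]$ and $c \in F^{\times}$ such that $\varphi_Y = g(t^p) + ct$. (ii) The polynomial $\varphi_Y'$ is a nonzero constant (i.e., has degree zero). (iii) The polynomial $\varphi_Y'$ is constant on $Y$ (i.e., $\varphi_Y'(x) = \varphi_Y'(y)$ for all $x,y \in Y$). (iv) The set $Y$ is Vandermonde of size a multiple of $p$.
   Context: For a finite nonempty subset $Y$ of a field $F$, $\varphi_Y(t) := \prod_{y \in Y} (t-y) \in F[t]$, and $\varphi_Y'$ is its formal derivative. For a finite subset $Y$ of a field $F$ of characteristic $p>0$ and $k \in \mathbb{Z}^+$, put $\pi_k(Y) := \sum_{y \in Y} y^k \in F$. If $\#Y \geq 2$, let $\omega(Y)$ be the least $k \in \mathbb{Z}^+$ such that $\pi_k(Y) \neq 0$ (such a $k$ exists, with $k \leq \# Y$). A finite subset $Y \subset F$ with $\# Y \geq 2$ is called Vandermonde if $\omega(Y) = \# Y - 1$. *)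

theory Defs
  imports "HOL-Computational_Algebra.Computational_Algebra"
begin

definition vanishing_poly :: "'a::field set \<Rightarrow> 'a poly"
  where "vanishing_poly Y = (\<Prod>y\<in>Y. [:- y, 1:])"

definition power_sum :: "nat \<Rightarrow> 'a::field set \<Rightarrow> 'a"
  where "power_sum k Y = (\<Sum>y\<in>Y. y ^ k)"

text \<open>
  Only meaningful for finite sets with at least two elements: there a positive exponent
  with nonvanishing power sum exists (at most the cardinality of the set), so that
  \<open>LEAST\<close> really denotes the minimum.
\<close>
definition omega :: "'a::field set \<Rightarrow> nat"
  where "omega Y = (LEAST k. k > 0 \<and> power_sum k Y \<noteq> 0)"

definition Vandermonde :: "'a::field set \<Rightarrow> bool"
  where "Vandermonde Y \<longleftrightarrow> finite Y \<and> card Y \<ge> 2 \<and> omega Y = card Y - 1"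

end

theory Submission
  imports Defs
begin

text \<open>
  Dividing \<open>\<phi> = vanishing_poly Y\<close> by \<open>t - y\<close> for each \<open>y \<in> Y\<close> and adding the quotients gives
  \<open>\<phi>'\<close>; comparing coefficients yields Newton's identities
  \<open>[t\<^bsup>r-1-m\<^esup>] \<phi>' = \<pi>\<^sub>m + \<Sum>\<^bsub>k<m\<^esub> a\<^bsub>r-m+k\<^esub> \<pi>\<^sub>k\<close> for \<open>m < r\<close>, where \<open>\<pi>\<^sub>0 = r\<close>. This system is
  unitriangular, so \<open>\<phi>'\<close> is constant iff \<open>\<pi>\<^sub>m = 0\<close> for all \<open>m < r - 1\<close>, the case \<open>m = 0\<close> saying
  that \<open>p\<close> divides \<open>r\<close>. Separability of \<open>\<phi>\<close> makes the constant nonzero, and \<open>\<phi>'\<close> is determined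
  by its values on \<open>Y\<close> because its degree is less than \<open>r\<close>.
\<close>

section \<open>Coefficients of the quotient by a linear factor\<close>

lemma coeff_synthetic_div_Suc:
  "coeff (synthetic_div f c) i = coeff f (Suc i) + c * coeff (synthetic_div f c) (Suc i)"
proof -
  have "coeff (f + smult c (synthetic_div f c)) (Suc i) =
        coeff (pCons (poly f c) (synthetic_div f c)) (Suc i)"
    by (simp only: synthetic_div_correct)
  then show ?thesis
    by simp
qed

text \<open>Horner's recurrence iterated \<open>n\<close> times, keeping the remaining tail
  explicit.\<close>

lemma coeff_synthetic_div_unroll:
  fixes f :: "'a::comm_semiring_1 poly"
  shows "coeff (synthetic_div f c) i =
     (\<Sum>k<n. coeff f (Suc i + k) * c ^ k) + c ^ n * coeff (synthetic_div f c) (i + n)"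
proof (induction n)
  case (Suc n)
  then show ?case
    by (simp add: coeff_synthetic_div_Suc[of f c "i + n"] algebra_simps)
qed simp

lemma coeff_synthetic_div:
  fixes f :: "'a::comm_semiring_1 poly"
  assumes "degree f \<le> i + n"
  shows "coeff (synthetic_div f c) i = (\<Sum>k<n. coeff f (Suc i + k) * c ^ k)"
proof -
  have "coeff (synthetic_div f c) (i + n) = 0"
  \<comment> \<open>\<open>degree_synthetic_div\<close> yields the truncated
    \<open>degree f - 1\<close>, which for constant \<open>f\<close> is not strictly below
    \<open>i + n\<close> when that sum is 0.\<close>
  proof (cases "degree f = 0")
    case True
    then have "synthetic_div f c = 0"
      by (simp add: synthetic_div_eq_0_iff)
    then show ?thesis
      by simp
  next
    case False
    with assms show ?thesis
      by (intro coeff_eq_0) (simp add: degree_synthetic_div)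
  qed
  then show ?thesis
    using coeff_synthetic_div_unroll[of f c i n] by simp
qed

section \<open>The vanishing polynomial and its derivative\<close>

lemma degree_vanishing_poly: "degree (vanishing_poly Y) = card Y"
  by (simp add: vanishing_poly_def degree_prod_sum_eq)

lemma coeff_vanishing_poly_card: "coeff (vanishing_poly Y) (card Y) = 1"
proof -
  have "lead_coeff (vanishing_poly Y) = 1"
    by (simp add: vanishing_poly_def lead_coeff_prod)
  then show ?thesis
    by (simp add: degree_vanishing_poly)
qed

lemma poly_vanishing_poly_eq_0:
  "finite Y \<Longrightarrow> y \<in> Y \<Longrightarrow> poly (vanishing_poly Y) y = 0"
  by (auto simp: vanishing_poly_def poly_prod)

lemma pderiv_vanishing_poly:
  "pderiv (vanishing_poly Y) = (\<Sum>y\<in>Y. \<Prod>z\<in>Y - {y}. [:- z, 1:])"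
  by (simp add: vanishing_poly_def pderiv_prod pderiv_pCons)

lemma synthetic_div_vanishing_poly:
  fixes Y :: "'a::field set"
  assumes "finite Y" "y \<in> Y"
  shows "synthetic_div (vanishing_poly Y) y = (\<Prod>z\<in>Y - {y}. [:- z, 1:])"
proof -
  have "[:- y, 1:] * synthetic_div (vanishing_poly Y) y = vanishing_poly Y"
    using synthetic_div_correct'[of y "vanishing_poly Y"] assms
    by (simp add: poly_vanishing_poly_eq_0)
  also have "\<dots> = [:- y, 1:] * (\<Prod>z\<in>Y - {y}. [:- z, 1:])"
    using assms unfolding vanishing_poly_def by (rule prod.remove)
  finally show ?thesis
    by (subst (asm) mult_left_cancel) simp_all
qed

text \<open>At \<open>x\<close>, every summand of the product rule with \<open>y\<close> other than
  \<open>x\<close> contains the factor \<open>x - x\<close>; what survives is a product of nonzero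
  differences.\<close>

lemma poly_pderiv_vanishing_poly_neq_0:
  assumes "finite Y" "x \<in> Y"
  shows "poly (pderiv (vanishing_poly Y)) x \<noteq> 0"
proof -
  have "poly (pderiv (vanishing_poly Y)) x = (\<Sum>y\<in>Y. \<Prod>z\<in>Y - {y}. x - z)"
    by (simp add: pderiv_vanishing_poly poly_sum poly_prod)
  also have "\<dots> = (\<Prod>z\<in>Y - {x}. x - z) + (\<Sum>y\<in>Y - {x}. \<Prod>z\<in>Y - {y}. x - z)"
    using assms by (rule sum.remove)
  also have "(\<Sum>y\<in>Y - {x}. \<Prod>z\<in>Y - {y}. x - z) = 0"
    using assms by (intro sum.neutral ballI prod_zero) auto
  finally show ?thesis
    using assms by auto
qed

section \<open>Newton's identities, power sums and the Vandermonde condition\<close>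

lemma newton_identity:
  assumes "finite Y" "m < card Y"
  shows "coeff (pderiv (vanishing_poly Y)) (card Y - 1 - m) =
    power_sum m Y + (\<Sum>k<m. coeff (vanishing_poly Y) (card Y - m + k) * power_sum k Y)"
proof -
  let ?f = "vanishing_poly Y" and ?i = "card Y - 1 - m"
  have i: "Suc ?i = card Y - m"
    using assms(2) by simp
  have "coeff (pderiv ?f) ?i = (\<Sum>y\<in>Y. coeff (synthetic_div ?f y) ?i)"
    using assms(1) by (simp add: pderiv_vanishing_poly coeff_sum synthetic_div_vanishing_poly)
  \<comment> \<open>Here \<open>?i + Suc m = card Y\<close> is the degree of \<open>?f\<close>, so
    \<open>Suc m\<close> terms suffice; the last one, \<open>k = m\<close>, carries the leading
    coefficient 1.\<close>
  also have "\<dots> = (\<Sum>y\<in>Y. \<Sum>k<Suc m. coeff ?f (Suc ?i + k) * y ^ k)"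
    using assms(2) by (intro sum.cong refl coeff_synthetic_div) (simp add: degree_vanishing_poly)
  also have "\<dots> = (\<Sum>k<Suc m. coeff ?f (card Y - m + k) * power_sum k Y)"
    unfolding i power_sum_def by (subst sum.swap) (simp only: sum_distrib_left)
  finally show ?thesis
    using assms(2) by (simp add: coeff_vanishing_poly_card)
qed

lemma coeff_pderiv_vanishing_poly_eq_0_iff:
  assumes "finite Y" "n \<le> card Y"
  shows "(\<forall>m<n. coeff (pderiv (vanishing_poly Y)) (card Y - 1 - m) = 0) \<longleftrightarrow>
         (\<forall>m<n. power_sum m Y = 0)"
  using assms(2)
proof (induction n)
  case (Suc n)
  \<comment> \<open>Once the lower power sums vanish, all correction terms in Newton's identity drop
    out.\<close>
  have "coeff (pderiv (vanishing_poly Y)) (card Y - 1 - n) = power_sum n Y"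
    if "\<forall>m<n. power_sum m Y = 0"
    using newton_identity[OF assms(1), of n] Suc.prems that by simp
  with Suc show ?case
    by (auto simp: less_Suc_eq)
qed simp

lemma degree_pderiv_vanishing_poly_less:
  "card Y > 0 \<Longrightarrow> degree (pderiv (vanishing_poly Y)) < card Y"
  by (intro degree_lessI) (auto simp: coeff_pderiv coeff_eq_0 degree_vanishing_poly)

lemma degree_pderiv_vanishing_poly_eq_0_iff:
  assumes "finite Y" "card Y > 0"
  shows "degree (pderiv (vanishing_poly Y)) = 0 \<longleftrightarrow> (\<forall>m<card Y - 1. power_sum m Y = 0)"
proof -
  let ?g = "pderiv (vanishing_poly Y)"
  have "degree ?g = 0 \<longleftrightarrow> (\<forall>i. 0 < i \<and> i < card Y \<longrightarrow> coeff ?g i = 0)"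
  proof
    assume *: "\<forall>i. 0 < i \<and> i < card Y \<longrightarrow> coeff ?g i = 0"
    show "degree ?g = 0"
    proof (rule ccontr)
      assume "degree ?g \<noteq> 0"
      with * degree_pderiv_vanishing_poly_less[OF assms(2)] have "lead_coeff ?g = 0"
        by blast
      then show False
        using \<open>degree ?g \<noteq> 0\<close> by simp
    qed
  qed (simp add: coeff_eq_0)
  \<comment> \<open>Reindexing by \<open>i = card Y - 1 - m\<close>; the excluded value
    \<open>m = card Y - 1\<close> is the constant coefficient.\<close>
  also have "\<dots> \<longleftrightarrow> (\<forall>m<card Y - 1. coeff ?g (card Y - 1 - m) = 0)"
  proof (intro iffI allI impI)
    fix i
    assume *: "\<forall>m<card Y - 1. coeff ?g (card Y - 1 - m) = 0" and i: "0 < i \<and> i < card Y"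
    then have "coeff ?g (card Y - 1 - (card Y - 1 - i)) = 0"
      by (intro *[rule_format]) linarith
    with i show "coeff ?g i = 0"
      by simp
  qed auto
  also have "\<dots> \<longleftrightarrow> (\<forall>m<card Y - 1. power_sum m Y = 0)"
    using assms(1) by (intro coeff_pderiv_vanishing_poly_eq_0_iff) auto
  finally show ?thesis .
qed

text \<open>If all these power sums vanished, the constant coefficient of the derivative would
  vanish along with the others, contradicting separability. This ensures that the minimum in
  \<open>omega\<close> is attained.\<close>

lemma power_sum_neq_0_exists:
  fixes Y :: "'a::field set"
  assumes "finite Y" "Y \<noteq> {}"
  shows "\<exists>m<card Y. power_sum m Y \<noteq> 0"
proof (rule ccontr)
  let ?g = "pderiv (vanishing_poly Y)"
  assume "\<not> ?thesis"
  then have *: "\<forall>m<card Y. power_sum m Y = 0"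
    by blast
  have "card Y > 0"
    using assms by (simp add: card_gt_0_iff)
  with * assms have "degree ?g = 0"
    by (subst degree_pderiv_vanishing_poly_eq_0_iff) auto
  moreover have "coeff ?g (card Y - 1 - (card Y - 1)) = 0"
    using coeff_pderiv_vanishing_poly_eq_0_iff[OF assms(1) order_refl] * \<open>card Y > 0\<close>
    by (meson diff_less zero_less_one)
  ultimately have "?g = 0"
    using leading_coeff_0_iff[of ?g] by simp
  moreover from assms(2) obtain x where "x \<in> Y"
    by blast
  ultimately show False
    using poly_pderiv_vanishing_poly_neq_0[OF assms(1)] by fastforce
qed

text \<open>\<open>omega\<close> ranges over positive exponents only; divisibility by the
  characteristic supplies the missing case \<open>m = 0\<close>.\<close>

lemma Vandermonde_iff:
  fixes Y :: "'a::field set"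
  assumes "finite Y" "card Y \<ge> 2" "CHAR('a) dvd card Y"
  shows "Vandermonde Y \<longleftrightarrow> (\<forall>m<card Y - 1. power_sum m Y = 0)"
proof -
  have power_sum_0: "power_sum 0 Y = 0"
    using assms(3) by (simp add: power_sum_def of_nat_eq_0_iff_char_dvd)
  obtain m where m: "m < card Y" "power_sum m Y \<noteq> 0"
    using power_sum_neq_0_exists[OF assms(1)] assms(2) by fastforce
  show ?thesis
  proof
    assume V: "Vandermonde Y"
    show "\<forall>k<card Y - 1. power_sum k Y = 0"
    proof (intro allI impI)
      fix k
      assume "k < card Y - 1"
      with V have "k < omega Y"
        by (simp add: Vandermonde_def)
      then show "power_sum k Y = 0"
        using not_less_Least[of k "\<lambda>k. k > 0 \<and> power_sum k Y \<noteq> 0"] power_sum_0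
        by (cases "k = 0") (auto simp: omega_def)
    qed
  next
    assume zero: "\<forall>k<card Y - 1. power_sum k Y = 0"
    \<comment> \<open>The nonzero power sum found below \<open>card Y\<close> can then only sit at
      \<open>card Y - 1\<close>.\<close>
    with m have "\<not> m < card Y - 1"
      by blast
    with m(1) have "m = card Y - 1"
      by linarith
    with m assms(2) zero have "omega Y = card Y - 1"
      unfolding omega_def by (intro Least_equality) (auto simp: not_less[symmetric])
    with assms show "Vandermonde Y"
      by (simp add: Vandermonde_def)
  qed
qed

section \<open>Polynomials in \<open>t^p\<close> and constant derivatives\<close>

lemma pcompose_monom: "pcompose (monom c n) q = smult c (q ^ n)"
  for q :: "'a::comm_semiring_1 poly"
  by (induction n) (simp_all add: monom_0 monom_Suc pcompose_pCons)

lemma pderiv_eq_0_imp_pcompose_monom: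
  fixes f :: "'a::field poly"
  assumes "pderiv f = 0" "CHAR('a) > 0"
  obtains g where "f = pcompose g (monom 1 CHAR('a))"
proof
  let ?p = "CHAR('a)"
  \<comment> \<open>\<open>?g\<close> collects the coefficients of \<open>f\<close> at multiples of
    \<open>?p\<close>; the others vanish because \<open>i * coeff f i = 0\<close>. The bound
    \<open>degree f\<close> is generous, since \<open>?p * j \<le> degree f\<close> forces
    \<open>j \<le> degree f\<close>.\<close>
  let ?g = "\<Sum>j\<le>degree f. monom (coeff f (?p * j)) j"
  have dvd: "?p dvd i" if "coeff f i \<noteq> 0" for i
  proof (cases i)
    case (Suc k)
    have "coeff (pderiv f) k = 0"
      using assms(1) by simp
    with that Suc have "of_nat i = (0::'a)"
      by (simp add: coeff_pderiv del: of_nat_Suc)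
    then show ?thesis
      by (simp add: of_nat_eq_0_iff_char_dvd)
  qed simp
  have "pcompose ?g (monom 1 ?p) = (\<Sum>j\<le>degree f. monom (coeff f (?p * j)) (?p * j))"
    by (simp add: pcompose_sum pcompose_monom monom_power smult_monom)
  also have "\<dots> = f"
  proof (rule poly_eqI)
    fix i
    have "coeff (\<Sum>j\<le>degree f. monom (coeff f (?p * j)) (?p * j)) i =
          (\<Sum>j\<le>degree f. if ?p * j = i then coeff f i else 0)"
      by (auto simp: coeff_sum intro!: sum.cong)
    also have "\<dots> = coeff f i"
    proof (cases "coeff f i = 0")
      case False
      with dvd obtain k where k: "i = ?p * k"
        by blast
      have "k \<le> i"
        using k assms(2) by simp
      also have "i \<le> degree f"
        using False by (rule le_degree)
      finally show ?thesis
        using k assms(2) by simp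
    qed (auto intro: sum.neutral)
    finally show "coeff (\<Sum>j\<le>degree f. monom (coeff f (?p * j)) (?p * j)) i = coeff f i" .
  qed
  finally show "f = pcompose ?g (monom 1 ?p)" ..
qed

lemma pderiv_pcompose_monom_CHAR:
  fixes g :: "'a::field poly"
  shows "pderiv (pcompose g (monom 1 CHAR('a))) = 0"
  by (simp add: pderiv_pcompose pderiv_monom)

lemma pderiv_const_iff_pcompose_monom:
  fixes f :: "'a::field poly"
  assumes "CHAR('a) > 0"
  shows "pderiv f = [:c:] \<longleftrightarrow> (\<exists>g. f = pcompose g (monom 1 CHAR('a)) + monom c 1)"
proof
  assume "pderiv f = [:c:]"
  \<comment> \<open>Removing the linear term \<open>c * t\<close> reduces to the case of zero
    derivative.\<close>
  then have "pderiv (f - monom c 1) = 0"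
    by (simp add: pderiv_diff pderiv_monom monom_0)
  then obtain g where "f - monom c 1 = pcompose g (monom 1 CHAR('a))"
    using assms by (rule pderiv_eq_0_imp_pcompose_monom)
  then have "f = pcompose g (monom 1 CHAR('a)) + monom c 1"
    by (simp add: diff_eq_eq)
  then show "\<exists>g. f = pcompose g (monom 1 CHAR('a)) + monom c 1" ..
qed (auto simp: pderiv_add pderiv_pcompose_monom_CHAR pderiv_monom monom_0)

lemma degree_pderiv_vanishing_poly_eq_0_iff_constant_on:
  assumes "finite Y" "card Y > 0"
  shows "degree (pderiv (vanishing_poly Y)) = 0 \<longleftrightarrow>
    (\<forall>x\<in>Y. \<forall>y\<in>Y. poly (pderiv (vanishing_poly Y)) x = poly (pderiv (vanishing_poly Y)) y)"
proof
  let ?g = "pderiv (vanishing_poly Y)"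
  assume *: "\<forall>x\<in>Y. \<forall>y\<in>Y. poly ?g x = poly ?g y"
  from assms(2) have "Y \<noteq> {}"
    by auto
  then obtain x where x: "x \<in> Y"
    by blast
  \<comment> \<open>Both sides have degree below \<open>card Y\<close> and agree at the
    \<open>card Y\<close> points of \<open>Y\<close>.\<close>
  have "?g = [:poly ?g x:]"
  proof (rule poly_eqI_degree[where A = Y])
    show "poly ?g y = poly [:poly ?g x:] y" if "y \<in> Y" for y
      using *[rule_format, OF that x] by simp
  qed (use degree_pderiv_vanishing_poly_less[OF assms(2)] assms(2) in simp_all)
  then have "degree ?g = degree [:poly ?g x:]"
    by (rule arg_cong)
  then show "degree ?g = 0"
    by simp
qed (auto elim!: degree_eq_zeroE)

theorem theorem2p4:
  fixes Y :: "'a::field set" and p r :: nat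
  assumes "CHAR('a) = p" and "p > 0"
    and "finite Y" and "card Y = r" and "r \<ge> 2"
  defines "i \<equiv> (\<exists>(g :: 'a poly) c. c \<noteq> 0 \<and>
                  vanishing_poly Y = pcompose g (monom 1 p) + monom c 1)"
    and "ii \<equiv> (pderiv (vanishing_poly Y) \<noteq> 0 \<and> degree (pderiv (vanishing_poly Y)) = 0)"
    and "iii \<equiv> (\<forall>x\<in>Y. \<forall>y\<in>Y. poly (pderiv (vanishing_poly Y)) x = poly (pderiv (vanishing_poly Y)) y)"
    and "iv \<equiv> (Vandermonde Y \<and> p dvd card Y)"
  shows "(i \<longleftrightarrow> ii) \<and> (ii \<longleftrightarrow> iii) \<and> (iii \<longleftrightarrow> iv)"
proof -
  let ?g = "pderiv (vanishing_poly Y)"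
  have card: "card Y > 0" "card Y \<ge> 2"
    using assms(4,5) by simp_all
  then obtain x where "x \<in> Y"
    by (metis card_gt_0_iff ex_in_conv)
  with \<open>finite Y\<close> have "poly ?g x \<noteq> 0"
    by (rule poly_pderiv_vanishing_poly_neq_0)
  \<comment> \<open>Separability settles the nonzero clause of \<open>ii\<close>, so only the degree
    remains to be compared with \<open>iii\<close> and \<open>iv\<close>.\<close>
  then have "?g \<noteq> 0"
    by auto
  have "i \<longleftrightarrow> (\<exists>c. c \<noteq> 0 \<and> ?g = [:c:])"
    unfolding i_def assms(1)[symmetric]
    using pderiv_const_iff_pcompose_monom[of "vanishing_poly Y"] assms(1,2) by auto
  also have "\<dots> \<longleftrightarrow> ii"
    unfolding ii_def by (auto elim!: degree_eq_zeroE)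
  finally have "i \<longleftrightarrow> ii" .
  moreover have "ii \<longleftrightarrow> iii"
    unfolding ii_def iii_def
    using degree_pderiv_vanishing_poly_eq_0_iff_constant_on[OF \<open>finite Y\<close> card(1)] \<open>?g \<noteq> 0\<close>
    by blast
  moreover have "ii \<longleftrightarrow> iv"
  proof -
    have "ii \<longleftrightarrow> (\<forall>m<card Y - 1. power_sum m Y = 0)"
      unfolding ii_def
      using degree_pderiv_vanishing_poly_eq_0_iff[OF \<open>finite Y\<close> card(1)] \<open>?g \<noteq> 0\<close> by blast
    moreover have "power_sum 0 Y = 0 \<longleftrightarrow> p dvd card Y"
      using assms(1) by (simp add: power_sum_def of_nat_eq_0_iff_char_dvd)
    \<comment> \<open>This puts \<open>m = 0\<close> in the range of vanishing power sums, so that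
      \<open>p dvd card Y\<close> can be extracted from \<open>ii\<close>.\<close>
    moreover have "0 < card Y - 1"
      using card by simp
    ultimately show ?thesis
      unfolding iv_def using Vandermonde_iff[OF \<open>finite Y\<close> card(2)] assms(1) by auto
  qed
  ultimately show ?thesis
    by blast
qed

end
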